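(* Let $k\colon R\to\mathbb{R}$ be a $W$-invariant multiplicity function with $k_\alpha\ge0$ for all $\alpha\in R$, and let $\lambda\in\mathfrak{a}_+$. Then there exists a constant $C=C_{R,k,\lambda}\ge0$ such that $$|\operatorname{Exp}_k(\lambda,x)|\le C\,e^{\langle\lambda,x\rangle}\,\Omega_k^{-1/2}(x)\qquad\text{for all }x\in\overline{\mathfrak{a}_+}.$$
   Context: $(\mathfrak{a},\langle\cdot,\cdot\rangle)$ is a finite-dimensional Euclidean space; $\langle\cdot,\cdot\rangle$ is extended to a complex bilinear form on $\mathfrak{a}_{\mathbb{C}}=\mathbb{C}\otimes_{\mathbb{R}}\mathfrak{a}$. $R\subseteq\mathfrak{a}$ is a reduced root system spanning $\mathfrak{a}$ (a finite set of nonzero vectors, stable under all its reflections, with $R\cap\mathbb{R}\alpha=\{\pm\alpha\}$; the crystallographic condition is not imposed), normalized by $\langle\alpha,\alpha\rangle=2$ for all $\alpha\in R$. $W$ is the finite reflection group generated by $s_\alpha(x)=x-\langle\alpha,x\rangle\alpha$, $\alpha\in R$. $R_+\subseteq R$ is a fixed set of positive roots, $\mathfrak{a}_+=\{x\in\mathfrak{a}:\langle\alpha,x\rangle>0\ \forall\alpha\in R_+\}$ is the open positive Weyl chamber and $\overline{\mathfrak{a}_+}$ its closure. For a $W$-invariant $k\colon R\to\mathbb{C}$, the Dunkl operator in direction $\xi\in\mathfrak{a}$ is $T_\xi=\partial_\xi+\sum_{\alpha\in R_+}k_\alpha\langle\alpha,\xi\rangle\frac{1-s_\alpha}{\langle\alpha,\cdot\rangle}$,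 where $(s_\alpha f)(x)=f(s_\alpha x)$. If $\operatorname{Re}k\ge0$, the Dunkl kernel $\operatorname{Exp}_k\colon\mathfrak{a}_{\mathbb{C}}\times\mathfrak{a}_{\mathbb{C}}\to\mathbb{C}$ is the unique holomorphic function such that for every $\lambda\in\mathfrak{a}_{\mathbb{C}}$, $f=\operatorname{Exp}_k(\lambda,\cdot)$ is the unique solution of $T_\xi f=\langle\xi,\lambda\rangle f$ for all $\xi\in\mathfrak{a}$, $f(0)=1$. $\Omega_k^{-1/2}(x)=\prod_{\alpha\in R_+}(1+|\langle\alpha,x\rangle|)^{-k_\alpha}$ for $x\in\mathfrak{a}$. *)

theory Defs
  imports "HOL-Analysis.Analysis"
begin

section \<open>Complexification of a Euclidean space\<close>

text \<open>The pair \<open>(x, y)\<close> stands for \<open>x + i y\<close>.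
  The bilinear form \<open>cform\<close> below is not the inner product of the product type.\<close>

type_synonym 'a cplx = "'a \<times> 'a"

definition cplx_of :: "'a::euclidean_space \<Rightarrow> 'a cplx" where
  "cplx_of x = (x, 0)"

definition cscale :: "complex \<Rightarrow> 'a::euclidean_space cplx \<Rightarrow> 'a cplx" where
  "cscale c z = (Re c *\<^sub>R fst z - Im c *\<^sub>R snd z, Re c *\<^sub>R snd z + Im c *\<^sub>R fst z)"

definition cform :: "'a::euclidean_space cplx \<Rightarrow> 'a cplx \<Rightarrow> complex" where
  "cform z w = Complex (fst z \<bullet> fst w - snd z \<bullet> snd w) (fst z \<bullet> snd w + snd z \<bullet> fst w)"

text \<open>Joint holomorphy on the product of two complexifications: the real derivative exists
  everywhere and is complex linear.\<close>

definition entire2 :: "('a::euclidean_space cplx \<Rightarrow> 'a cplx \<Rightarrow> complex) \<Rightarrow> bool" where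
  "entire2 F \<longleftrightarrow>
     (\<forall>p. \<exists>D. ((\<lambda>(z, w). F z w) has_derivative D) (at p) \<and>
       (\<forall>c z w. D (cscale c z, cscale c w) = c * D (z, w)))"

section \<open>Root systems\<close>

text \<open>All roots are normalized to squared length 2, so no division by \<open>\<alpha> \<bullet> \<alpha>\<close> is needed.\<close>

definition refl_root :: "'a::euclidean_space \<Rightarrow> 'a \<Rightarrow> 'a" where
  "refl_root \<alpha> x = x - (\<alpha> \<bullet> x) *\<^sub>R \<alpha>"

definition root_system :: "'a::euclidean_space set \<Rightarrow> bool" where
  "root_system R \<longleftrightarrow>
     finite R \<and> 0 \<notin> R \<and> span R = UNIV \<and>
     (\<forall>\<alpha>\<in>R. refl_root \<alpha> ` R \<subseteq> R) \<and>
     (\<forall>\<alpha>\<in>R. R \<inter> range (\<lambda>c. c *\<^sub>R \<alpha>) = {\<alpha>, - \<alpha>}) \<and>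
     (\<forall>\<alpha>\<in>R. \<alpha> \<bullet> \<alpha> = 2)"

text \<open>Reflections are involutions, so closing under composition with them yields the
  generated group.\<close>

inductive_set weyl_group :: "'a::euclidean_space set \<Rightarrow> ('a \<Rightarrow> 'a) set"
  for R :: "'a set" where
  weyl_id: "id \<in> weyl_group R"
| weyl_refl: "\<alpha> \<in> R \<Longrightarrow> w \<in> weyl_group R \<Longrightarrow> refl_root \<alpha> \<circ> w \<in> weyl_group R"

definition weyl_invariant :: "'a::euclidean_space set \<Rightarrow> ('a \<Rightarrow> 'b) \<Rightarrow> bool" where
  "weyl_invariant R k \<longleftrightarrow> (\<forall>w\<in>weyl_group R. \<forall>\<alpha>\<in>R. k (w \<alpha>) = k \<alpha>)"

definition positive_roots :: "'a::euclidean_space set \<Rightarrow> 'a set \<Rightarrow> bool" where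
  "positive_roots R P \<longleftrightarrow> (\<exists>v. (\<forall>\<alpha>\<in>R. \<alpha> \<bullet> v \<noteq> 0) \<and> P = {\<alpha>\<in>R. \<alpha> \<bullet> v > 0})"

definition weyl_chamber :: "'a::euclidean_space set \<Rightarrow> 'a set" where
  "weyl_chamber P = {x. \<forall>\<alpha>\<in>P. \<alpha> \<bullet> x > 0}"

section \<open>Dunkl operators and the Dunkl kernel\<close>

text \<open>On the hyperplane \<open>\<alpha> \<bullet> x = 0\<close> the difference quotient is given its continuous
  extension: \<open>f x - f (x - (\<alpha> \<bullet> x) \<alpha>)\<close>, divided by \<open>\<alpha> \<bullet> x\<close>, tends to the derivative
  of \<open>f\<close> in direction \<open>\<alpha>\<close>.\<close>

definition dunkl_quotient ::
    "'a::euclidean_space \<Rightarrow> ('a \<Rightarrow> complex) \<Rightarrow> 'a \<Rightarrow> complex" where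
  "dunkl_quotient \<alpha> f x =
     (if \<alpha> \<bullet> x = 0 then frechet_derivative f (at x) \<alpha>
      else (f x - f (refl_root \<alpha> x)) / of_real (\<alpha> \<bullet> x))"

definition dunkl_op ::
    "'a::euclidean_space set \<Rightarrow> ('a \<Rightarrow> complex) \<Rightarrow> 'a \<Rightarrow> ('a \<Rightarrow> complex) \<Rightarrow> 'a \<Rightarrow> complex" where
  "dunkl_op P k \<xi> f x =
     frechet_derivative f (at x) \<xi> + (\<Sum>\<alpha>\<in>P. k \<alpha> * of_real (\<alpha> \<bullet> \<xi>) * dunkl_quotient \<alpha> f x)"

text \<open>The defining properties of the Dunkl kernel; for multiplicities with nonnegative real
  part they determine \<open>E\<close> uniquely. The eigenvalue equations are required on the real space,
  where the Dunkl operators act; as \<open>E\<close> is holomorphic, they then hold on the complexification.\<close>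

definition is_dunkl_kernel ::
    "'a::euclidean_space set \<Rightarrow> ('a \<Rightarrow> complex) \<Rightarrow> ('a cplx \<Rightarrow> 'a cplx \<Rightarrow> complex) \<Rightarrow> bool" where
  "is_dunkl_kernel P k E \<longleftrightarrow>
     entire2 E \<and>
     (\<forall>\<mu>. E \<mu> 0 = 1 \<and>
       (\<forall>\<xi> x. dunkl_op P k \<xi> (\<lambda>y. E \<mu> (cplx_of y)) x
               = cform (cplx_of \<xi>) \<mu> * E \<mu> (cplx_of x)))"

definition Omega_inv_sqrt :: "'a::euclidean_space set \<Rightarrow> ('a \<Rightarrow> real) \<Rightarrow> 'a \<Rightarrow> real" where
  "Omega_inv_sqrt P k x = (\<Prod>\<alpha>\<in>P. (1 + \<bar>\<alpha> \<bullet> x\<bar>) powr (- k \<alpha>))"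

end

theory Submission
  imports Defs
begin

text \<open>Let \<open>f = Exp\<^sub>k(\<mu>, \<cdot>)\<close> and let \<open>x\<close> be dominant. Along the rays \<open>t \<mapsto> t z\<close> through the Weyl
  orbit of \<open>x\<close> the eigenvalue equations become the linear system
  \<open>d/dt f(t z) = (z \<bullet> \<mu>) f(t z) - t\<^sup>-\<^sup>1 \<Sum>\<^sub>\<alpha> k\<^sub>\<alpha> (f(t z) - f(t s\<^sub>\<alpha> z))\<close>.
  It is cooperative, so it suffices to find a supersolution, and
  \<open>exp (t \<mu> \<bullet> x) \<Prod>\<^sub>\<alpha> (1 + \<epsilon> t \<bar>\<alpha> \<bullet> z\<bar>) powr - k\<^sub>\<alpha> / (1 + t q\<^sub>z)\<close> with
  \<open>q\<^sub>z = (\<mu> \<bullet> x - \<mu> \<bullet> z) / K\<close> is one for small \<open>\<epsilon>\<close> and large \<open>K\<close>. The reason is that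
  \<open>\<mu> \<bullet> s\<^sub>\<alpha> z = \<mu> \<bullet> z - (\<alpha> \<bullet> z) (\<alpha> \<bullet> \<mu>)\<close>, so with \<open>s = s\<^sub>\<alpha>\<close> one of \<open>q\<^sub>z\<close>, \<open>q\<^bsub>s z\<^esub>\<close> controls \<open>\<bar>\<alpha> \<bullet> z\<bar>\<close>: either
  the damping at \<open>z\<close> absorbs the coupling, or the coupled component is small.
  Since \<open>q\<^sub>x = 0\<close>, the component \<open>z = x\<close> at \<open>t = 1\<close> gives the bound.
  That \<open>q\<^sub>z \<ge> 0\<close> is the fact that a dominant vector maximizes \<open>\<mu> \<bullet> z\<close> over its orbit.\<close>

section \<open>Reflections and Weyl groups\<close>

lemma linear_refl_root: "linear (refl_root \<alpha>)"
  by (rule linearI) (simp_all add: refl_root_def algebra_simps inner_add_right)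

lemma refl_root_involution:
  assumes "\<alpha> \<bullet> \<alpha> = 2" shows "refl_root \<alpha> (refl_root \<alpha> x) = x"
  using assms by (simp add: refl_root_def inner_diff_right algebra_simps)

lemma inner_refl_root_left: "refl_root \<alpha> x \<bullet> y = x \<bullet> refl_root \<alpha> y"
  by (simp add: refl_root_def inner_diff_right inner_diff_left inner_commute)

lemma refl_root_uminus: "refl_root \<alpha> (- x) = - refl_root \<alpha> x"
  by (simp add: refl_root_def)

lemma refl_root_scaleR: "refl_root \<alpha> (t *\<^sub>R x) = t *\<^sub>R refl_root \<alpha> x"
  by (simp add: refl_root_def algebra_simps)

text \<open>The map \<open>refl_root \<alpha>\<close> is orthogonal, so it carries the reflection in
  \<beta> to the reflection in its image. This moves reflections past words.\<close>

lemma refl_root_conj: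
  assumes "\<alpha> \<bullet> \<alpha> = 2"
  shows "refl_root (refl_root \<alpha> \<beta>) (refl_root \<alpha> x) = refl_root \<alpha> (refl_root \<beta> x)"
proof -
  have "refl_root \<alpha> \<beta> \<bullet> refl_root \<alpha> x = \<beta> \<bullet> x"
    by (simp add: inner_refl_root_left refl_root_involution assms)
  then show ?thesis
    unfolding refl_root_def[of "refl_root \<alpha> \<beta>"] refl_root_def[of \<beta>]
    by (simp add: linear_diff[OF linear_refl_root] refl_root_scaleR)
qed

lemma root_system_refl:
  assumes "root_system R" "\<alpha> \<in> R" "\<beta> \<in> R"
  shows "refl_root \<alpha> \<beta> \<in> R"
  using assms unfolding root_system_def by blast

lemma root_system_norm: "root_system R \<Longrightarrow> \<alpha> \<in> R \<Longrightarrow> \<alpha> \<bullet> \<alpha> = 2"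
  unfolding root_system_def by blast

lemma refl_root_self: "\<alpha> \<bullet> \<alpha> = 2 \<Longrightarrow> refl_root \<alpha> \<alpha> = - \<alpha>"
  by (simp add: refl_root_def scaleR_2)

lemma root_system_uminus: "root_system R \<Longrightarrow> \<alpha> \<in> R \<Longrightarrow> - \<alpha> \<in> R"
  by (metis refl_root_self root_system_norm root_system_refl)

lemma weyl_group_linear: "w \<in> weyl_group R \<Longrightarrow> linear w"
proof (induction rule: weyl_group.induct)
  case weyl_id
  show ?case by (simp add: id_def linear_ident)
next
  case (weyl_refl \<alpha> w)
  then show ?case by (intro linear_compose linear_refl_root)
qed

lemma weyl_group_root:
  assumes "root_system R" and "w \<in> weyl_group R" and "\<alpha> \<in> R"
  shows "w \<alpha> \<in> R"
  using assms(2) by induction (simp_all add: assms(3) root_system_refl[OF assms(1)])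

lemma refl_root_in_weyl_group: "\<alpha> \<in> R \<Longrightarrow> refl_root \<alpha> \<in> weyl_group R"
  using weyl_refl[OF _ weyl_id, of \<alpha> R] by simp

text \<open>Elements are linear and the roots span, so each is determined by its action on the
  finite set \<open>R\<close>, which it maps to itself.\<close>

lemma finite_weyl_group:
  assumes R: "root_system R"
  shows "finite (weyl_group R)"
proof (rule inj_on_finite)
  show "inj_on (\<lambda>w. restrict w R) (weyl_group R)"
  proof (rule inj_onI)
    fix v w assume vw: "v \<in> weyl_group R" "w \<in> weyl_group R" "restrict v R = restrict w R"
    then have "v \<alpha> = w \<alpha>" if "\<alpha> \<in> R" for \<alpha>
      using that by (metis restrict_apply')
    then have "v x = w x" if "x \<in> span R" for x
      using linear_eq_on_span[OF weyl_group_linear[OF vw(1)] weyl_group_linear[OF vw(2)]] that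
      by metis
    moreover have "span R = UNIV" using R unfolding root_system_def by blast
    ultimately show "v = w" by (simp add: fun_eq_iff)
  qed
  show "(\<lambda>w. restrict w R) ` weyl_group R \<subseteq> (\<Pi>\<^sub>E \<alpha>\<in>R. R)"
    by (auto intro: weyl_group_root[OF R])
  show "finite (\<Pi>\<^sub>E \<alpha>\<in>R. R)"
    using R by (intro finite_PiE) (auto simp: root_system_def)
qed

lemma inner_nonneg_closure_weyl_chamber:
  assumes "x \<in> closure (weyl_chamber P)" and "\<alpha> \<in> P"
  shows "0 \<le> \<alpha> \<bullet> x"
proof -
  have "closure (weyl_chamber P) \<subseteq> {x. 0 \<le> \<alpha> \<bullet> x}"
    using assms(2)
    by (intro closure_minimal closed_halfspace_ge) (auto simp: weyl_chamber_def less_imp_le)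
  then show ?thesis using assms(1) by blast
qed

section \<open>Dominance\<close>

text \<open>The spectral parameter \<mu> serves twice: it gives the eigenvalues, and pairing with it
  separates positive from negative roots.\<close>

locale chamber_vector =
  fixes R P :: "'a::euclidean_space set" and \<mu> :: 'a
  assumes root_system: "root_system R"
    and positive: "positive_roots R P"
    and chamber: "\<mu> \<in> weyl_chamber P"
begin

lemma roots_eq: "R = P \<union> uminus ` P"
proof -
  obtain v where v: "\<forall>\<alpha>\<in>R. \<alpha> \<bullet> v \<noteq> 0" "P = {\<alpha>\<in>R. \<alpha> \<bullet> v > 0}"
    using positive unfolding positive_roots_def by blast
  have "\<alpha> \<in> P \<union> uminus ` P" if "\<alpha> \<in> R" for \<alpha>
  proof (cases "\<alpha> \<bullet> v > 0")
    case False
    then have "- \<alpha> \<in> P"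
      using v that root_system_uminus[OF root_system that] by (auto simp: less_le)
    then show ?thesis by force
  qed (use v that in auto)
  then show ?thesis using v(2) root_system_uminus[OF root_system] by auto
qed

lemma finite_P: "finite P"
  using root_system roots_eq unfolding root_system_def by simp

lemma P_subset: "P \<subseteq> R"
  using roots_eq by blast

lemma inner_chamber_pos: "\<alpha> \<in> P \<Longrightarrow> 0 < \<alpha> \<bullet> \<mu>"
  using chamber unfolding weyl_chamber_def by blast

lemma uminus_notin_P: "\<alpha> \<in> P \<Longrightarrow> - \<alpha> \<notin> P"
  using inner_chamber_pos[of \<alpha>] inner_chamber_pos[of "- \<alpha>"] by auto

lemma uminus_in_P: "\<alpha> \<in> R \<Longrightarrow> \<alpha> \<notin> P \<Longrightarrow> - \<alpha> \<in> P"
  using roots_eq by auto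

section \<open>Simple systems as minimal generators of the positive cone\<close>

definition generates :: "'a set \<Rightarrow> bool" where
  "generates B \<longleftrightarrow>
     B \<subseteq> P \<and> (\<forall>\<beta>\<in>P. \<exists>c. (\<forall>b\<in>B. 0 \<le> c b) \<and> \<beta> = (\<Sum>b\<in>B. c b *\<^sub>R b))"

lemma generates_P: "generates P"
  unfolding generates_def
proof (intro conjI ballI)
  fix \<beta> assume "\<beta> \<in> P"
  then show "\<exists>c. (\<forall>b\<in>P. 0 \<le> c b) \<and> \<beta> = (\<Sum>b\<in>P. c b *\<^sub>R b)"
    using finite_P by (intro exI[of _ "\<lambda>b. if b = \<beta> then 1 else 0"]) (simp add: if_distrib[of "\<lambda>c. c *\<^sub>R _"] cong: if_cong)
qed simp

lemma generates_remove:
  assumes B: "generates B" and a: "a \<in> B"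
    and c: "\<forall>b\<in>B - {a}. 0 \<le> c b" "a = (\<Sum>b\<in>B - {a}. c b *\<^sub>R b)"
  shows "generates (B - {a})"
  unfolding generates_def
proof (intro conjI ballI)
  show "B - {a} \<subseteq> P" using B unfolding generates_def by blast
  have fin: "finite B" using B finite_P finite_subset unfolding generates_def by blast
  fix \<beta> assume "\<beta> \<in> P"
  then obtain d where d: "\<forall>b\<in>B. 0 \<le> d b" "\<beta> = (\<Sum>b\<in>B. d b *\<^sub>R b)"
    using B unfolding generates_def by blast
  have "\<beta> = d a *\<^sub>R a + (\<Sum>b\<in>B - {a}. d b *\<^sub>R b)"
    using d(2) fin a by (simp add: sum.remove)
  also have "\<dots> = d a *\<^sub>R (\<Sum>b\<in>B - {a}. c b *\<^sub>R b) + (\<Sum>b\<in>B - {a}. d b *\<^sub>R b)"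
    using c(2) by simp
  also have "\<dots> = (\<Sum>b\<in>B - {a}. (d a * c b + d b) *\<^sub>R b)"
    by (simp add: scaleR_sum_right sum.distrib scaleR_add_left)
  finally show "\<exists>c. (\<forall>b\<in>B - {a}. 0 \<le> c b) \<and> \<beta> = (\<Sum>b\<in>B - {a}. c b *\<^sub>R b)"
    using c(1) d(1) a by (intro exI[of _ "\<lambda>b. d a * c b + d b"]) auto
qed

text \<open>The second clause is the classical fact that a simple reflection permutes the positive
  roots other than its own, taken here as defining.\<close>

definition simple_system :: "'a set \<Rightarrow> bool" where
  "simple_system B \<longleftrightarrow> generates B \<and> (\<forall>a\<in>B. \<forall>\<beta>\<in>P. \<beta> \<noteq> a \<longrightarrow> refl_root a \<beta> \<in> P)"

text \<open>A generating set of the cone of minimal cardinality is a simple system: if a generator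
  \<open>a\<close> reflected some other positive root to a negative one, it would be redundant.\<close>

lemma simple_system_exists: "\<exists>B. simple_system B"
proof -
  obtain B where B: "generates B" and min: "\<And>B'. generates B' \<Longrightarrow> card B \<le> card B'"
    using ex_has_least_nat[of generates P card] generates_P by blast
  have BP: "B \<subseteq> P" using B unfolding generates_def by blast
  have fin: "finite B" using BP finite_P finite_subset by blast
  have "refl_root a \<beta> \<in> P" if a: "a \<in> B" and \<beta>: "\<beta> \<in> P" "\<beta> \<noteq> a" for a \<beta>
  proof (rule ccontr)
    assume neg: "refl_root a \<beta> \<notin> P"
    have aR: "a \<in> R" "\<beta> \<in> R" using a \<beta> BP P_subset by blast+
    then have "- refl_root a \<beta> \<in> P"
      using neg uminus_in_P root_system_refl[OF root_system] by blast
    then obtain d where d: "\<forall>b\<in>B. 0 \<le> d b" "- refl_root a \<beta> = (\<Sum>b\<in>B. d b *\<^sub>R b)"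
      using B unfolding generates_def by blast
    obtain c where c: "\<forall>b\<in>B. 0 \<le> c b" "\<beta> = (\<Sum>b\<in>B. c b *\<^sub>R b)"
      using B \<beta> unfolding generates_def by blast
    define S where "S = (\<Sum>b\<in>B - {a}. (c b + d b) *\<^sub>R b)"
    define m where "m = a \<bullet> \<beta> - c a - d a"
    \<comment> \<open>Expanding \<beta> and \<open>- refl_root a \<beta>\<close> over
      \<open>B\<close> and collecting \<open>a\<close> exhibits \<open>m *\<^sub>R a\<close> as a
      nonnegative combination of the other generators.\<close>
    have "(a \<bullet> \<beta>) *\<^sub>R a = \<beta> - refl_root a \<beta>" by (simp add: refl_root_def)
    also have "\<dots> = (\<Sum>b\<in>B. c b *\<^sub>R b) + (\<Sum>b\<in>B. d b *\<^sub>R b)" using c d by simp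
    also have "\<dots> = (\<Sum>b\<in>B. (c b + d b) *\<^sub>R b)" by (simp add: sum.distrib scaleR_add_left)
    also have "\<dots> = (c a + d a) *\<^sub>R a + S" unfolding S_def using fin a by (simp add: sum.remove)
    finally have S: "S = m *\<^sub>R a" by (simp add: m_def algebra_simps)
    \<comment> \<open>Reducedness enters here: a positive root proportional to \<open>a\<close> is
      \<open>a\<close> itself. The strict coefficient makes \<open>S \<bullet> \<mu>\<close>, and
      hence \<open>m\<close>, positive.\<close>
    have ex: "\<exists>b\<in>B - {a}. 0 < c b"
    proof (rule ccontr)
      assume "\<not> ?thesis"
      then have "c b = 0" if "b \<in> B - {a}" for b using c(1) that by (metis DiffD1 less_eq_real_def)
      then have "\<beta> = c a *\<^sub>R a" using c(2) fin a by (simp add: sum.remove)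
      then have "\<beta> \<in> {a, - a}"
        using root_system aR unfolding root_system_def by blast
      then show False using \<beta> a BP uminus_notin_P by blast
    qed
    have "0 < S \<bullet> \<mu>" unfolding S_def inner_sum_left
    proof -
      obtain b where b: "b \<in> B - {a}" "0 < c b" using ex by blast
      have pos: "0 < b' \<bullet> \<mu>" "0 \<le> c b' + d b'" if "b' \<in> B - {a}" for b'
        using that BP inner_chamber_pos c d by (auto intro: add_nonneg_nonneg)
      have "0 < (c b + d b) *\<^sub>R b \<bullet> \<mu>" using b d pos[OF b(1)] by (auto intro!: mult_pos_pos add_pos_nonneg)
      moreover have "0 \<le> (c b' + d b') *\<^sub>R b' \<bullet> \<mu>" if "b' \<in> B - {a}" for b'
        using pos[OF that] by simp
      ultimately show "0 < (\<Sum>b\<in>B - {a}. (c b + d b) *\<^sub>R b \<bullet> \<mu>)"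
        using fin b(1) by (intro sum_pos2[OF _ b(1)]) auto
    qed
    then have m: "0 < m" using S inner_chamber_pos[of a] a BP by (auto simp: zero_less_mult_iff)
    have "a = (1 / m) *\<^sub>R S" using S m by simp
    then have "a = (\<Sum>b\<in>B - {a}. ((c b + d b) / m) *\<^sub>R b)"
      by (simp add: S_def scaleR_sum_right)
    then have "generates (B - {a})"
      using m c d by (intro generates_remove[OF B a, where c = "\<lambda>b. (c b + d b) / m"]) auto
    then have "card B \<le> card (B - {a})" by (rule min)
    then show False using a fin by (metis card_Diff1_less not_less)
  qed
  then show ?thesis using B unfolding simple_system_def by blast
qed

section \<open>Words in simple reflections and the exchange property\<close>

lemma simple_system_subset: "simple_system B \<Longrightarrow> B \<subseteq> R"
  using P_subset unfolding simple_system_def generates_def by blast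

text \<open>Words are lists of simple roots whose head acts last. Conjugating a reflection by a word
  gives the reflection in the moved root, letter by letter from
  \<open>refl_root_conj\<close>.\<close>

lemma word_conj:
  assumes "simple_system B" "set as \<subseteq> B"
  shows "foldr refl_root as (refl_root \<beta> x)
    = refl_root (foldr refl_root as \<beta>) (foldr refl_root as x)"
  using assms(2)
proof (induction as)
  case (Cons a as)
  then have "a \<bullet> a = 2"
    using root_system_norm[OF root_system] simple_system_subset[OF assms(1)] by auto
  with Cons show ?case by (simp add: refl_root_conj)
qed simp

lemma word_rev:
  assumes "simple_system B" "set as \<subseteq> B"
  shows "foldr refl_root as (foldr refl_root (rev as) x) = x"
  using assms(2)
proof (induction as arbitrary: x)
  case (Cons a as)
  then have "a \<bullet> a = 2"
    using root_system_norm[OF root_system] simple_system_subset[OF assms(1)] by auto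
  with Cons show ?case by (simp add: refl_root_involution)
qed simp

text \<open>Among the positive roots linked to \<beta> by words, let \<delta> have the least pairing
  with \<mu>. If \<delta> were not in \<open>B\<close>, simple reflections would keep it positive
  and could not lower the pairing, so its inner product with every generator would be nonpositive.
  Being a nonnegative combination of them, it would satisfy
  \<open>\<delta> \<bullet> \<delta> \<le> 0\<close>.\<close>

lemma root_conj_simple:
  assumes B: "simple_system B" and \<beta>: "\<beta> \<in> P"
  shows "\<exists>as a. set as \<subseteq> B \<and> a \<in> B \<and> \<beta> = foldr refl_root as a"
proof -
  define Q where "Q = {\<delta>\<in>P. \<exists>as. set as \<subseteq> B \<and> \<beta> = foldr refl_root as \<delta>}"
  have "finite Q" "Q \<noteq> {}"
    using \<beta> finite_P by (auto simp: Q_def intro!: exI[of _ \<beta>] exI[of _ "[]"])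
  then obtain \<delta> where \<delta>: "\<delta> \<in> Q" and min: "\<And>\<gamma>. \<gamma> \<in> Q \<Longrightarrow> \<delta> \<bullet> \<mu> \<le> \<gamma> \<bullet> \<mu>"
    using ex_is_arg_min_if_finite[of Q "\<lambda>\<gamma>. \<gamma> \<bullet> \<mu>"] by (auto simp: is_arg_min_linorder)
  obtain as where as: "set as \<subseteq> B" "\<beta> = foldr refl_root as \<delta>" and dP: "\<delta> \<in> P"
    using \<delta> unfolding Q_def by blast
  have "\<delta> \<in> B"
  proof (rule ccontr)
    assume nB: "\<delta> \<notin> B"
    have le: "\<delta> \<bullet> a \<le> 0" if a: "a \<in> B" for a
    proof -
      have aP: "a \<in> P" using a B unfolding simple_system_def generates_def by blast
      have n: "a \<bullet> a = 2" using aP P_subset root_system_norm[OF root_system] by blast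
      have "refl_root a \<delta> \<in> P" using B a nB dP unfolding simple_system_def by auto
      moreover have "\<beta> = foldr refl_root (as @ [a]) (refl_root a \<delta>)"
        using as n by (simp add: refl_root_involution)
      ultimately have "refl_root a \<delta> \<in> Q" unfolding Q_def using as a
        by (intro CollectI conjI exI[of _ "as @ [a]"]) auto
      from min[OF this] have "(a \<bullet> \<delta>) * (a \<bullet> \<mu>) \<le> 0"
        by (simp add: refl_root_def inner_diff_left)
      then show ?thesis using inner_chamber_pos[OF aP]
        by (simp add: mult_le_0_iff inner_commute)
    qed
    obtain c where c: "\<forall>b\<in>B. 0 \<le> c b" "\<delta> = (\<Sum>b\<in>B. c b *\<^sub>R b)"
      using B dP unfolding simple_system_def generates_def by blast
    have "\<delta> \<bullet> \<delta> = (\<Sum>b\<in>B. c b * (\<delta> \<bullet> b))"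
      by (subst (2) c(2)) (simp add: inner_sum_right)
    also have "\<dots> \<le> 0" using c le by (intro sum_nonpos mult_nonneg_nonpos) auto
    finally show False using root_system_norm[OF root_system, of \<delta>] dP P_subset by auto
  qed
  then show ?thesis using as by blast
qed

text \<open>Up to sign every root is a word applied to a simple root \<open>a\<close>, so its
  reflection is the word \<open>as @ [a] @ rev as\<close>.\<close>

lemma weyl_group_word:
  assumes B: "simple_system B" and w: "w \<in> weyl_group R"
  shows "\<exists>as. set as \<subseteq> B \<and> w = foldr refl_root as"
  using w
proof induction
  case weyl_id
  show ?case by (rule exI[of _ "[]"]) auto
next
  case (weyl_refl \<alpha> w)
  then obtain bs where bs: "set bs \<subseteq> B" "w = foldr refl_root bs" by blast
  obtain \<beta> where \<beta>: "\<beta> \<in> P" "refl_root \<alpha> = refl_root \<beta>"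
  proof (cases "\<alpha> \<in> P")
    case False
    then show ?thesis
      using that[of "- \<alpha>"] uminus_in_P weyl_refl.hyps(1) by (simp add: refl_root_def fun_eq_iff)
  qed (use that in blast)
  obtain as a where as: "set as \<subseteq> B" "a \<in> B" "\<beta> = foldr refl_root as a"
    using root_conj_simple[OF B \<beta>(1)] by blast
  have "refl_root \<beta> x = foldr refl_root (as @ [a] @ rev as) x" for x
    using word_conj[OF B as(1), of a "foldr refl_root (rev as) x"] word_rev[OF B as(1), of x] as
    by simp
  then have "refl_root \<alpha> \<circ> w = foldr refl_root ((as @ [a] @ rev as) @ bs)"
    using \<beta> bs by (auto simp: fun_eq_iff)
  then show ?case using as bs by (intro exI[of _ "(as @ [a] @ rev as) @ bs"]) auto
qed

text \<open>The word turns the positive root \<open>a\<close> negative, so some letter does the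
  turning. A simple reflection does this only to its own root, so that letter cancels against the
  appended \<open>a\<close> and both drop out.\<close>

lemma word_exchange:
  assumes B: "simple_system B" and "set as \<subseteq> B" and a: "a \<in> B"
    and "foldr refl_root as a \<notin> P"
  shows "\<exists>bs. set bs \<subseteq> B \<and> length bs < length as \<and>
    foldr refl_root (as @ [a]) = foldr refl_root bs"
  using assms(2,4)
proof (induction as)
  case Nil
  then show ?case using B a unfolding simple_system_def generates_def by auto
next
  case (Cons b as)
  show ?case
  proof (cases "foldr refl_root as a \<in> P")
    case True
    then have eq: "foldr refl_root as a = b"
      using B Cons.prems unfolding simple_system_def by auto
    have n: "b \<bullet> b = 2"
      using Cons.prems root_system_norm[OF root_system] simple_system_subset[OF B] by auto
    have "foldr refl_root ((b # as) @ [a]) x = foldr refl_root as x" for x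
      using word_conj[OF B, of as a x] Cons.prems eq n by (simp add: refl_root_involution)
    then show ?thesis using Cons.prems by (intro exI[of _ as]) auto
  next
    case False
    moreover have "set as \<subseteq> B" using Cons.prems by simp
    ultimately obtain bs where bs: "set bs \<subseteq> B" "length bs < length as"
      "foldr refl_root (as @ [a]) = foldr refl_root bs"
      using Cons.IH by blast
    have "foldr refl_root ((b # as) @ [a]) = refl_root b \<circ> foldr refl_root (as @ [a])"
      by (simp add: fun_eq_iff)
    then have "foldr refl_root ((b # as) @ [a]) = foldr refl_root (b # bs)"
      unfolding bs(3) by (simp add: fun_eq_iff)
    then show ?thesis using Cons.prems bs by (intro exI[of _ "b # bs"]) auto
  qed
qed

text \<open>Induction on length, splitting off the letter \<open>a\<close> that acts first. If the
  remaining word keeps \<open>a\<close> positive, that letter only subtracts a nonnegative multiple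
  of a positive root; otherwise the exchange property gives a shorter word for the same map.\<close>

lemma inner_word_le:
  assumes B: "simple_system B" and "set as \<subseteq> B" and x: "\<And>\<alpha>. \<alpha> \<in> P \<Longrightarrow> 0 \<le> \<alpha> \<bullet> x"
  shows "\<mu> \<bullet> foldr refl_root as x \<le> \<mu> \<bullet> x"
  using assms(2)
proof (induction as rule: length_induct)
  case (1 as)
  show ?case
  proof (cases as rule: rev_cases)
    case (snoc bs a)
    have bs: "set bs \<subseteq> B" "a \<in> B" using snoc 1 by auto
    have lin: "linear (foldr refl_root bs)"
    proof (induction bs)
      case (Cons b bs)
      then have "linear (refl_root b \<circ> foldr refl_root bs)"
        by (rule linear_compose[OF _ linear_refl_root])
      then show ?case by (simp add: comp_def)
    qed (simp add: id_def linear_ident)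
    show ?thesis
    proof (cases "foldr refl_root bs a \<in> P")
      case True
      have "foldr refl_root as x = foldr refl_root bs x - (a \<bullet> x) *\<^sub>R foldr refl_root bs a"
        using snoc lin by (simp add: refl_root_def linear_diff linear_scale)
      moreover have "0 \<le> (a \<bullet> x) * (\<mu> \<bullet> foldr refl_root bs a)"
        using bs B x inner_chamber_pos[OF True] unfolding simple_system_def generates_def
        by (intro mult_nonneg_nonneg) (auto simp: inner_commute)
      moreover have "\<mu> \<bullet> foldr refl_root bs x \<le> \<mu> \<bullet> x" using 1 snoc bs by auto
      ultimately show ?thesis by (simp add: inner_diff_right)
    next
      case False
      then obtain cs where cs: "set cs \<subseteq> B" "length cs < length bs"
        "foldr refl_root as = foldr refl_root cs"
        using word_exchange[OF B bs] snoc by blast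
      then have "length cs < length as" using snoc by simp
      with cs 1 show ?thesis by metis
    qed
  qed simp
qed

lemma inner_weyl_group_le:
  assumes "w \<in> weyl_group R" and "x \<in> closure (weyl_chamber P)"
  shows "\<mu> \<bullet> w x \<le> \<mu> \<bullet> x"
proof -
  obtain B where B: "simple_system B" using simple_system_exists by blast
  obtain as where "set as \<subseteq> B" "w = foldr refl_root as"
    using weyl_group_word[OF B assms(1)] by blast
  then show ?thesis
    using inner_word_le[OF B] inner_nonneg_closure_weyl_chamber[OF assms(2)] by blast
qed

text \<open>Up to sign \<open>refl_root \<beta>\<close> permutes \<open>P\<close>, and neither
  \<open>k\<close> nor the absolute value sees the sign. The logarithmic weight used later therefore
  agrees at a point and its reflection.\<close>

lemma sum_P_refl_invariant:
  assumes k: "weyl_invariant R k" and \<beta>: "\<beta> \<in> R"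
  shows "(\<Sum>\<alpha>\<in>P. g (k \<alpha>) \<bar>\<alpha> \<bullet> refl_root \<beta> x\<bar>) = (\<Sum>\<alpha>\<in>P. g (k \<alpha>) \<bar>\<alpha> \<bullet> x\<bar>)"
proof -
  define p where "p \<alpha> = (if refl_root \<beta> \<alpha> \<in> P then refl_root \<beta> \<alpha> else - refl_root \<beta> \<alpha>)" for \<alpha>
  have n: "\<beta> \<bullet> \<beta> = 2" using \<beta> by (rule root_system_norm[OF root_system])
  \<comment> \<open>The root \<open>- \<alpha>\<close> is the image of \<alpha> under its own
    reflection.\<close>
  have kp: "k (- \<alpha>) = k \<alpha>" if "\<alpha> \<in> R" for \<alpha>
    using k that refl_root_in_weyl_group[OF that] refl_root_self[OF root_system_norm[OF root_system that]]
    unfolding weyl_invariant_def by metis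
  have k\<beta>: "k (refl_root \<beta> \<alpha>) = k \<alpha>" if "\<alpha> \<in> R" for \<alpha>
    using k that refl_root_in_weyl_group[OF \<beta>] unfolding weyl_invariant_def by blast
  have P: "\<alpha> \<in> R" "refl_root \<beta> \<alpha> \<in> R" if "\<alpha> \<in> P" for \<alpha>
    using that P_subset root_system_refl[OF root_system \<beta>] by blast+
  have pP: "p \<alpha> \<in> P" if "\<alpha> \<in> P" for \<alpha>
    using uminus_in_P[OF P(2)[OF that]] by (simp add: p_def)
  have pp: "p (p \<alpha>) = \<alpha>" if "\<alpha> \<in> P" for \<alpha>
    using that uminus_notin_P[OF that] by (simp add: p_def refl_root_uminus refl_root_involution[OF n])
  have kk: "k (p \<alpha>) = k \<alpha>" "\<bar>p \<alpha> \<bullet> refl_root \<beta> x\<bar> = \<bar>\<alpha> \<bullet> x\<bar>" if "\<alpha> \<in> P" for \<alpha>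
    using P[OF that] k\<beta> kp
    by (simp_all add: p_def inner_refl_root_left[of \<beta> \<alpha>] refl_root_involution[OF n])
  show ?thesis
    by (rule sum.reindex_bij_witness[of _ p p]) (metis pp pP kk)+
qed

text \<open>The two pairings differ by
  \<open>(\<alpha> \<bullet> z) * (\<alpha> \<bullet> \<mu>)\<close>, of size at least
  \<open>c * \<bar>\<alpha> \<bullet> z\<bar>\<close>, so the smaller one lies at least that far
  below \<open>m\<close>.\<close>

lemma inner_gap_dichotomy:
  assumes "\<alpha> \<in> P" and c: "0 \<le> c" "\<And>\<alpha>. \<alpha> \<in> P \<Longrightarrow> c \<le> \<alpha> \<bullet> \<mu>"
    and "\<mu> \<bullet> z \<le> m" "\<mu> \<bullet> refl_root \<alpha> z \<le> m"
  shows "c * \<bar>\<alpha> \<bullet> z\<bar> \<le> m - \<mu> \<bullet> refl_root \<alpha> z \<or> c * \<bar>\<alpha> \<bullet> z\<bar> \<le> m - \<mu> \<bullet> z"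
proof -
  have eq: "\<mu> \<bullet> refl_root \<alpha> z = \<mu> \<bullet> z - (\<alpha> \<bullet> z) * (\<alpha> \<bullet> \<mu>)"
    by (simp add: refl_root_def inner_diff_right inner_commute)
  have "c * \<bar>\<alpha> \<bullet> z\<bar> \<le> (\<alpha> \<bullet> \<mu>) * \<bar>\<alpha> \<bullet> z\<bar>"
    using c(2)[OF assms(1)] by (rule mult_right_mono) simp
  then have "c * \<bar>\<alpha> \<bullet> z\<bar> \<le> \<bar>(\<alpha> \<bullet> z) * (\<alpha> \<bullet> \<mu>)\<bar>"
    using inner_chamber_pos[OF assms(1)] by (simp add: abs_mult mult.commute)
  then show ?thesis using assms(4,5) eq by linarith
qed

end

section \<open>The Dunkl system along an orbit of rays\<close>

text \<open>In direction \<open>z\<close> at the point \<open>t *\<^sub>R z\<close> the factor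
  \<open>\<alpha> \<bullet> z\<close> cancels against the denominator, leaving \<open>1 / t\<close>.
  On the hyperplane both summands vanish.\<close>

lemma dunkl_op_ray:
  assumes "0 < t"
  shows "dunkl_op P k z f (t *\<^sub>R z) = frechet_derivative f (at (t *\<^sub>R z)) z +
    (\<Sum>\<alpha>\<in>P. k \<alpha> * (f (t *\<^sub>R z) - f (t *\<^sub>R refl_root \<alpha> z))) / of_real t"
proof -
  have "k \<alpha> * of_real (\<alpha> \<bullet> z) * dunkl_quotient \<alpha> f (t *\<^sub>R z)
      = k \<alpha> * (f (t *\<^sub>R z) - f (t *\<^sub>R refl_root \<alpha> z)) / of_real t" for \<alpha>
  proof (cases "\<alpha> \<bullet> z = 0")
    case True
    then show ?thesis by (simp add: refl_root_def)
  next
    case False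
    then show ?thesis using assms by (simp add: dunkl_quotient_def refl_root_scaleR)
  qed
  then show ?thesis by (simp add: dunkl_op_def sum_divide_distrib)
qed

lemma dunkl_ray_derivative:
  assumes f: "f differentiable at (t *\<^sub>R z)" and t: "0 < t"
    and eq: "dunkl_op P k z f (t *\<^sub>R z) = of_real l * f (t *\<^sub>R z)"
  shows "((\<lambda>t. f (t *\<^sub>R z)) has_vector_derivative of_real l * f (t *\<^sub>R z) -
    (\<Sum>\<alpha>\<in>P. k \<alpha> * (f (t *\<^sub>R z) - f (t *\<^sub>R refl_root \<alpha> z))) / of_real t) (at t)"
proof -
  have "((\<lambda>t. t *\<^sub>R z) has_vector_derivative z) (at t)"
    by (auto intro!: derivative_eq_intros)
  moreover have "(f has_derivative frechet_derivative f (at (t *\<^sub>R z))) (at (t *\<^sub>R z))"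
    using f by (simp add: frechet_derivative_works)
  ultimately have "((f \<circ> (\<lambda>t. t *\<^sub>R z)) has_vector_derivative
      frechet_derivative f (at (t *\<^sub>R z)) z) (at t)"
    by (intro vector_derivative_diff_chain_within) (auto intro: has_derivative_at_withinI)
  moreover have "frechet_derivative f (at (t *\<^sub>R z)) z = of_real l * f (t *\<^sub>R z) -
      (\<Sum>\<alpha>\<in>P. k \<alpha> * (f (t *\<^sub>R z) - f (t *\<^sub>R refl_root \<alpha> z))) / of_real t"
    using eq unfolding dunkl_op_ray[OF t] by (simp only: eq_diff_eq)
  ultimately show ?thesis by (simp add: comp_def)
qed

section \<open>A maximum principle for weighted systems\<close>

text \<open>The damping factor \<open>exp (- \<delta> t)\<close> used below makes the derivative at an
  interior maximum strictly negative.\<close>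

lemma weighted_maximum_principle:
  fixes u :: "'i \<Rightarrow> real \<Rightarrow> 'b::real_inner" and L L' :: "'i \<Rightarrow> real \<Rightarrow> real"
  assumes fin: "finite I"
    and cont: "\<And>i. i \<in> I \<Longrightarrow> continuous_on {0..1} (u i)"
      "\<And>i. i \<in> I \<Longrightarrow> continuous_on {0..1} (L i)"
    and deriv: "\<And>i t. i \<in> I \<Longrightarrow> 0 < t \<Longrightarrow> t \<le> 1 \<Longrightarrow> (u i has_vector_derivative u' i t) (at t)"
      "\<And>i t. i \<in> I \<Longrightarrow> 0 < t \<Longrightarrow> t \<le> 1 \<Longrightarrow> (L i has_real_derivative L' i t) (at t)"
    and init: "\<And>i. i \<in> I \<Longrightarrow> norm (u i 0) * exp (L i 0) \<le> 1"
    and max: "\<And>i t. i \<in> I \<Longrightarrow> 0 < t \<Longrightarrow> t \<le> 1 \<Longrightarrow>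
        (\<And>j. j \<in> I \<Longrightarrow> norm (u j t) * exp (L j t) \<le> norm (u i t) * exp (L i t)) \<Longrightarrow>
        u i t \<bullet> u' i t + L' i t * (norm (u i t))\<^sup>2 \<le> 0"
    and i: "i \<in> I"
  shows "norm (u i 1) * exp (L i 1) \<le> 1"
proof -
  have damped: "norm (u i 1) * exp (L i 1) \<le> exp \<delta>" if \<delta>: "0 < \<delta>" for \<delta>
  proof -
    \<comment> \<open>Squaring the damped weighted norm keeps it differentiable for positive times
      even where \<open>u j\<close> vanishes.\<close>
    define G where "G j t = (exp (L j t - \<delta> * t))\<^sup>2 * (u j t \<bullet> u j t)" for j t
    have G_eq: "G j t = (norm (u j t) * exp (L j t) * exp (- \<delta> * t))\<^sup>2" for j t
      by (simp add: G_def dot_square_norm power_mult_distrib exp_diff exp_minus field_simps)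
    have "\<exists>s\<in>{0..1}. \<forall>t\<in>{0..1}. G j t \<le> G j s" if "j \<in> I" for j
      using cont[OF that] unfolding G_def
      by (intro continuous_attains_sup continuous_intros) auto
    then obtain \<tau> where \<tau>: "\<And>j. j \<in> I \<Longrightarrow> \<tau> j \<in> {0..1}"
      "\<And>j t. j \<in> I \<Longrightarrow> t \<in> {0..1} \<Longrightarrow> G j t \<le> G j (\<tau> j)" by metis
    obtain j where j: "j \<in> I" "\<And>l. l \<in> I \<Longrightarrow> G l (\<tau> l) \<le> G j (\<tau> j)"
    proof -
      have ne: "(\<lambda>l. G l (\<tau> l)) ` I \<noteq> {}" using i by blast
      have "Max ((\<lambda>l. G l (\<tau> l)) ` I) \<in> (\<lambda>l. G l (\<tau> l)) ` I"
        using fin ne by (intro Max_in) auto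
      then obtain j where "j \<in> I" "Max ((\<lambda>l. G l (\<tau> l)) ` I) = G j (\<tau> j)" by blast
      moreover have "G l (\<tau> l) \<le> Max ((\<lambda>l. G l (\<tau> l)) ` I)" if "l \<in> I" for l
        using fin that by simp
      ultimately show ?thesis using that by metis
    qed
    define s where "s = \<tau> j"
    have s: "0 \<le> s" "s \<le> 1" using \<tau>(1)[OF j(1)] by (auto simp: s_def)
    \<comment> \<open>The pair \<open>(j, s)\<close> is a joint maximum over components and times,
      so \<open>j\<close> dominates at time \<open>s\<close>, as \<open>max\<close> demands.\<close>
    have G_le: "G l t \<le> G j s" if "l \<in> I" "t \<in> {0..1}" for l t
      using \<tau>(2)[OF that] j(2)[OF that(1)] by (simp add: s_def)
    have "G j s \<le> 1"
    proof (cases "s = 0")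
      case True
      then show ?thesis using init[OF j(1)] by (simp add: G_eq power_le_one)
    next
      case False
      then have s0: "0 < s" using s by simp
      have "norm (u l s) * exp (L l s) \<le> norm (u j s) * exp (L j s)" if "l \<in> I" for l
      proof -
        have "G l s \<le> G j s" using G_le[OF that] s by simp
        then have "norm (u l s) * exp (L l s) * exp (- \<delta> * s) \<le> norm (u j s) * exp (L j s) * exp (- \<delta> * s)"
          unfolding G_eq by (rule power2_le_imp_le) simp
        then show ?thesis by (rule mult_right_le_imp_le) simp
      qed
      from max[OF j(1) s0 s(2) this]
      have le: "u j s \<bullet> u' j s + L' j s * (norm (u j s))\<^sup>2 \<le> 0" .
      define D where "D = 2 * (exp (L j s - \<delta> * s))\<^sup>2 *
        (u j s \<bullet> u' j s + (L' j s - \<delta>) * (norm (u j s))\<^sup>2)"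
      have "((\<lambda>t. u j t \<bullet> u j t) has_real_derivative 2 * (u j s \<bullet> u' j s)) (at s)"
        using has_derivative_inner[OF deriv(1)[OF j(1) s0 s(2), unfolded has_vector_derivative_def]
            deriv(1)[OF j(1) s0 s(2), unfolded has_vector_derivative_def]]
        unfolding has_field_derivative_def by (rule has_derivative_eq_rhs)
          (simp add: fun_eq_iff inner_commute)
      moreover have "((\<lambda>t. (exp (L j t - \<delta> * t))\<^sup>2) has_real_derivative
          2 * (exp (L j s - \<delta> * s))\<^sup>2 * (L' j s - \<delta>)) (at s)"
        by (auto intro!: derivative_eq_intros deriv(2)[OF j(1) s0 s(2)] simp: power2_eq_square)
      ultimately have "(G j has_real_derivative D) (at s)"
        unfolding G_def
        by (auto intro!: DERIV_cong[OF DERIV_mult] simp: D_def algebra_simps dot_square_norm)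
      \<comment> \<open>Only times before \<open>s\<close> are compared, which also covers
        \<open>s = 1\<close>.\<close>
      moreover have "\<not> D < 0"
      proof
        assume "D < 0"
        with \<open>(G j has_real_derivative D) (at s)\<close>
        obtain d where d: "0 < d" "\<And>h. 0 < h \<Longrightarrow> h < d \<Longrightarrow> G j s < G j (s - h)"
          using DERIV_neg_dec_left by blast
        define h where "h = min (d / 2) s"
        have "0 < h" "h < d" "s - h \<in> {0..1}" using d s s0 by (auto simp: h_def)
        then show False using d(2)[of h] G_le[OF j(1), of "s - h"] by simp
      qed
      moreover have "D < 0" if "u j s \<noteq> 0"
      proof -
        have "0 < \<delta> * (norm (u j s))\<^sup>2" using that \<delta> by simp
        then have "u j s \<bullet> u' j s + (L' j s - \<delta>) * (norm (u j s))\<^sup>2 < 0"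
          using le by (simp add: left_diff_distrib)
        then show ?thesis unfolding D_def by (intro mult_pos_neg) auto
      qed
      ultimately have "u j s = 0" by blast
      then show ?thesis by (simp add: G_def)
    qed
    then have "G i 1 \<le> 1" using G_le[OF i, of 1] by simp
    then have "(norm (u i 1) * exp (L i 1) * exp (- \<delta>))\<^sup>2 \<le> 1" by (simp add: G_eq)
    then have "norm (u i 1) * exp (L i 1) * exp (- \<delta>) \<le> 1"
      by (simp add: power_le_one_iff abs_square_le_1)
    then show ?thesis by (simp add: exp_minus field_simps)
  qed
  \<comment> \<open>Now \<delta> tends to 0, on a logarithmic scale; this is why a vanishing value
    is split off.\<close>
  show ?thesis
  proof (cases "u i 1 = 0")
    case False
    define X where "X = norm (u i 1) * exp (L i 1)"
    have pos: "0 < X" using False by (simp add: X_def)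
    have "ln X \<le> 0 + \<delta>" if "0 < \<delta>" for \<delta>
    proof -
      have "exp (ln X) \<le> exp \<delta>" using damped[OF that] pos by (simp add: X_def)
      then show ?thesis by simp
    qed
    then have "ln X \<le> 0" by (rule field_le_epsilon)
    then show ?thesis using pos by (simp add: X_def[symmetric])
  qed simp
qed

section \<open>The supersolution estimate for Dunkl eigenfunctions\<close>

context chamber_vector
begin

text \<open>The weight \<open>exp (L z t)\<close> is the reciprocal of the supersolution, and the
  weighted norm starts at 1 on every ray. The scaling of \<open>x\<close> in the bound is the small
  factor \<epsilon>.\<close>

lemma dunkl_eigenfunction_bound:
  fixes k :: "'a \<Rightarrow> real" and f :: "'a \<Rightarrow> complex"
  assumes k: "weyl_invariant R k" "\<And>\<alpha>. \<alpha> \<in> P \<Longrightarrow> 0 \<le> k \<alpha>"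
    and f: "\<And>y. f differentiable at y" and f0: "f 0 = 1"
    and eig: "\<And>\<xi> y. dunkl_op P (\<lambda>\<alpha>. of_real (k \<alpha>)) \<xi> f y = of_real (\<xi> \<bullet> \<mu>) * f y"
    and c: "0 < c" "\<And>\<alpha>. \<alpha> \<in> P \<Longrightarrow> c \<le> \<alpha> \<bullet> \<mu>"
    and x: "x \<in> closure (weyl_chamber P)"
  shows "cmod (f x) \<le> exp (\<mu> \<bullet> x) *
    Omega_inv_sqrt P k ((c / (1 + 2 * (\<Sum>\<alpha>\<in>P. k \<alpha>))) *\<^sub>R x)"
proof -
  define \<kappa> where "\<kappa> = (\<Sum>\<alpha>\<in>P. k \<alpha>)"
  \<comment> \<open>The summand \<open>2 * \<kappa>\<close> pays for the terms
    \<open>2 * Q z\<close> of the coupling estimate, summed with weights \<open>k \<alpha>\<close>;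
    the 1 pays for the derivative of \<open>ln (1 + t * q z)\<close>.\<close>
  define K where "K = 1 + 2 * \<kappa>"
  \<comment> \<open>The divisor \<open>K\<close> matches the one in \<open>q\<close>, so the gap
    dichotomy compares \<open>\<epsilon> * \<bar>\<alpha> \<bullet> z\<bar>\<close> directly with
    \<open>q\<close>.\<close>
  define \<epsilon> where "\<epsilon> = c / K"
  have "0 \<le> \<kappa>" unfolding \<kappa>_def using k(2) by (rule sum_nonneg)
  then have K: "1 \<le> K" by (simp add: K_def)
  then have \<epsilon>: "0 < \<epsilon>" using c by (simp add: \<epsilon>_def)
  define I where "I = (\<lambda>w. w x) ` weyl_group R"
  have finI: "finite I" unfolding I_def using finite_weyl_group[OF root_system] by simp
  have xI: "x \<in> I" unfolding I_def by (rule image_eqI[OF _ weyl_id]) simp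
  have reflI: "refl_root \<alpha> z \<in> I" if az: "\<alpha> \<in> P" "z \<in> I" for \<alpha> z
  proof -
    obtain w where w: "w \<in> weyl_group R" "z = w x" using az unfolding I_def by blast
    have "refl_root \<alpha> \<circ> w \<in> weyl_group R" using az P_subset w by (blast intro: weyl_refl)
    then show ?thesis unfolding I_def w(2) by (rule image_eqI[rotated]) simp
  qed
  have gap: "\<mu> \<bullet> z \<le> \<mu> \<bullet> x" if "z \<in> I" for z
    using that inner_weyl_group_le[OF _ x] unfolding I_def by blast
  define S where "S z t = (\<Sum>\<alpha>\<in>P. k \<alpha> * ln (1 + \<epsilon> * t * \<bar>\<alpha> \<bullet> z\<bar>))" for z t
  define q where "q z = (\<mu> \<bullet> x - \<mu> \<bullet> z) / K" for z
  have q: "0 \<le> q z" if "z \<in> I" for z using gap[OF that] K by (simp add: q_def)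
  define L where "L z t = - (\<mu> \<bullet> x) * t + S z t + ln (1 + t * q z)" for z t
  define L' where "L' z t = - (\<mu> \<bullet> x) +
    (\<Sum>\<alpha>\<in>P. k \<alpha> * (\<epsilon> * \<bar>\<alpha> \<bullet> z\<bar> / (1 + \<epsilon> * t * \<bar>\<alpha> \<bullet> z\<bar>))) + q z / (1 + t * q z)" for z t
  define u where "u z t = f (t *\<^sub>R z)" for z t
  define u' where "u' z t = of_real (z \<bullet> \<mu>) * u z t -
    (\<Sum>\<alpha>\<in>P. of_real (k \<alpha>) * (u z t - u (refl_root \<alpha> z) t)) / of_real t" for z t
  have pos: "0 < 1 + \<epsilon> * t * \<bar>\<alpha> \<bullet> z\<bar>" "0 < 1 + t * q z" if "z \<in> I" "0 \<le> t" for \<alpha> z t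
    using that q \<epsilon> by (auto intro!: add_pos_nonneg mult_nonneg_nonneg)
  have "norm (u x 1) * exp (L x 1) \<le> 1"
  proof (rule weighted_maximum_principle[OF finI, where u = u and L = L and u' = u' and L' = L'])
    fix z assume z: "z \<in> I"
    show "continuous_on {0..1} (u z)" unfolding u_def
    proof (rule continuous_on_compose2[of UNIV f])
      show "continuous_on UNIV f"
        using f differentiable_imp_continuous_within by (blast intro: continuous_at_imp_continuous_on)
    qed (auto intro!: continuous_intros)
    show "continuous_on {0..1} (L z)" unfolding L_def S_def
      using pos[OF z] by (intro continuous_intros) (auto simp: less_imp_neq[symmetric])
    show "norm (u z 0) * exp (L z 0) \<le> 1" by (simp add: u_def f0 L_def S_def)
  next
    fix z t assume z: "z \<in> I" and t: "0 < t" "t \<le> (1::real)"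
    show "(u z has_vector_derivative u' z t) (at t)"
      unfolding u_def u'_def by (rule dunkl_ray_derivative[OF f t(1) eig])
    have "((\<lambda>t. k \<alpha> * ln (1 + \<epsilon> * t * \<bar>\<alpha> \<bullet> z\<bar>)) has_real_derivative
        k \<alpha> * (\<epsilon> * \<bar>\<alpha> \<bullet> z\<bar> / (1 + \<epsilon> * t * \<bar>\<alpha> \<bullet> z\<bar>))) (at t)" for \<alpha>
      using pos(1)[OF z less_imp_le[OF t(1)], of \<alpha>] by (auto intro!: derivative_eq_intros)
    then have "(S z has_real_derivative
        (\<Sum>\<alpha>\<in>P. k \<alpha> * (\<epsilon> * \<bar>\<alpha> \<bullet> z\<bar> / (1 + \<epsilon> * t * \<bar>\<alpha> \<bullet> z\<bar>)))) (at t)"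
      unfolding S_def by (intro DERIV_sum) auto
    moreover have "((\<lambda>t. ln (1 + t * q z)) has_real_derivative q z / (1 + t * q z)) (at t)"
      using pos(2)[OF z less_imp_le[OF t(1)]] by (auto intro!: derivative_eq_intros)
    moreover have "((\<lambda>t. - (\<mu> \<bullet> x) * t) has_real_derivative - (\<mu> \<bullet> x)) (at t)"
      by (auto intro!: derivative_eq_intros)
    ultimately show "(L z has_real_derivative L' z t) (at t)"
      unfolding L_def L'_def by (intro DERIV_add)
    assume max: "\<And>y. y \<in> I \<Longrightarrow> norm (u y t) * exp (L y t) \<le> norm (u z t) * exp (L z t)"
    define U where "U = norm (u z t)"
    \<comment> \<open>Both \<open>Q\<close> and \<open>Y\<close> carry a factor \<open>t\<close>:
      the required inequality is proved after multiplication by \<open>t\<close>, which clears the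
      singular \<open>1 / t\<close>.\<close>
    define Q where "Q y = t * q y" for y
    define Y where "Y \<alpha> = \<epsilon> * t * \<bar>\<alpha> \<bullet> z\<bar>" for \<alpha>
    have Q0: "0 \<le> Q y" if "y \<in> I" for y using q[OF that] t by (simp add: Q_def)
    have Y0: "0 \<le> Y \<alpha>" for \<alpha> using \<epsilon> t by (simp add: Y_def)
    \<comment> \<open>Since \<open>S\<close> agrees at \<open>z\<close> and its reflection,
      maximality bounds the reflected component by \<open>U\<close> times a ratio of the factors
      \<open>1 + Q\<close>.\<close>
    have refl: "u z t \<bullet> u (refl_root \<alpha> z) t \<le> (1 / (1 + Y \<alpha>) + 2 * Q z) * U\<^sup>2"
      if \<alpha>: "\<alpha> \<in> P" for \<alpha>
    proof -
      let ?y = "refl_root \<alpha> z"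
      have y: "?y \<in> I" using reflI[OF \<alpha> z] .
      have "S ?y t = S z t" unfolding S_def
        using \<alpha> P_subset
          sum_P_refl_invariant[OF k(1), of \<alpha> "\<lambda>\<kappa> a. \<kappa> * ln (1 + \<epsilon> * t * a)" z] by auto
      moreover have "exp (L y t) = exp (- (\<mu> \<bullet> x) * t + S y t) * (1 + Q y)" if "y \<in> I" for y
        using pos(2)[OF that, of t] t by (simp add: L_def exp_add Q_def)
      ultimately have "norm (u ?y t) * (exp (- (\<mu> \<bullet> x) * t + S z t) * (1 + Q ?y))
          \<le> U * (exp (- (\<mu> \<bullet> x) * t + S z t) * (1 + Q z))"
        using max[OF y] y z by (simp add: U_def)
      then have "exp (- (\<mu> \<bullet> x) * t + S z t) * (norm (u ?y t) * (1 + Q ?y))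
          \<le> exp (- (\<mu> \<bullet> x) * t + S z t) * (U * (1 + Q z))"
        by (simp only: mult_ac)
      then have "norm (u ?y t) * (1 + Q ?y) \<le> U * (1 + Q z)"
        by (rule mult_left_le_imp_le) simp
      then have "norm (u ?y t) \<le> (1 + Q z) / (1 + Q ?y) * U"
        using Q0[OF y] by (simp add: field_simps)
      \<comment> \<open>If \<open>Y \<alpha> \<le> Q ?y\<close>, the denominator supplies the decay.
        If \<open>Y \<alpha> \<le> Q z\<close>, the ratio is at most \<open>1 + Q z\<close>, and
        \<open>1 \<le> 1 / (1 + Y \<alpha>) + Q z\<close>.\<close>
      also have "(1 + Q z) / (1 + Q ?y) \<le> 1 / (1 + Y \<alpha>) + 2 * Q z"
      proof -
        have "c * \<bar>\<alpha> \<bullet> z\<bar> \<le> K * q ?y \<or> c * \<bar>\<alpha> \<bullet> z\<bar> \<le> K * q z"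
          using inner_gap_dichotomy[OF \<alpha> _ c(2) gap[OF z] gap[OF y]] c K by (simp add: q_def)
        then have "\<epsilon> * \<bar>\<alpha> \<bullet> z\<bar> \<le> q ?y \<or> \<epsilon> * \<bar>\<alpha> \<bullet> z\<bar> \<le> q z"
          using K by (simp add: \<epsilon>_def field_simps)
        then have "Y \<alpha> \<le> Q ?y \<or> Y \<alpha> \<le> Q z"
          using t by (auto simp: Y_def Q_def mult.assoc mult.left_commute[of \<epsilon> t])
        then show ?thesis
        proof
          assume "Y \<alpha> \<le> Q ?y"
          then have "(1 + Q z) / (1 + Q ?y) \<le> (1 + Q z) / (1 + Y \<alpha>)"
            using Y0[of \<alpha>] Q0[OF z] by (intro divide_left_mono) auto
          also have "\<dots> = 1 / (1 + Y \<alpha>) + Q z / (1 + Y \<alpha>)" by (simp add: add_divide_distrib)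
          also have "Q z / (1 + Y \<alpha>) \<le> Q z / 1"
            using Y0[of \<alpha>] Q0[OF z] by (intro divide_left_mono) auto
          finally show ?thesis using Q0[OF z] by simp
        next
          assume le: "Y \<alpha> \<le> Q z"
          have "(1 + Q z) / (1 + Q ?y) \<le> (1 + Q z) / 1"
            using Q0[OF y] Q0[OF z] by (intro divide_left_mono) auto
          moreover have "1 - Y \<alpha> \<le> 1 / (1 + Y \<alpha>)"
            using Y0[of \<alpha>] by (simp add: field_simps)
          ultimately show ?thesis using le by simp
        qed
      qed
      finally have "norm (u ?y t) \<le> (1 / (1 + Y \<alpha>) + 2 * Q z) * U"
        by (simp add: U_def mult_right_mono)
      then have "U * norm (u ?y t) \<le> U * ((1 / (1 + Y \<alpha>) + 2 * Q z) * U)"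
        by (rule mult_left_mono) (simp add: U_def)
      with norm_cauchy_schwarz[of "u z t" "u ?y t"] show ?thesis
        by (simp add: U_def power2_eq_square mult_ac)
    qed
    have inner_u': "t * (u z t \<bullet> u' z t) =
        t * (z \<bullet> \<mu>) * U\<^sup>2 - (\<Sum>\<alpha>\<in>P. k \<alpha> * (U\<^sup>2 - u z t \<bullet> u (refl_root \<alpha> z) t))"
    proof -
      have "t *\<^sub>R u' z t = (t * (z \<bullet> \<mu>)) *\<^sub>R u z t -
          (\<Sum>\<alpha>\<in>P. k \<alpha> *\<^sub>R (u z t - u (refl_root \<alpha> z) t))"
        using t by (simp add: u'_def scaleR_conv_of_real right_diff_distrib)
      then have "u z t \<bullet> (t *\<^sub>R u' z t) = u z t \<bullet> ((t * (z \<bullet> \<mu>)) *\<^sub>R u z t -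
          (\<Sum>\<alpha>\<in>P. k \<alpha> *\<^sub>R (u z t - u (refl_root \<alpha> z) t)))" by simp
      then show ?thesis
        by (simp add: inner_diff_right inner_sum_right dot_square_norm U_def)
    qed
    \<comment> \<open>The gap between \<open>z\<close> and the dominant point \<open>x\<close> is
      the source of the damping.\<close>
    have "t * (z \<bullet> \<mu> - \<mu> \<bullet> x) = - (K * Q z)"
      using K by (simp add: Q_def q_def inner_commute field_simps)
    moreover have "t * L' z t = - t * (\<mu> \<bullet> x) + (\<Sum>\<alpha>\<in>P. k \<alpha> * (1 - 1 / (1 + Y \<alpha>))) + Q z / (1 + Q z)"
    proof -
      have "t * (k \<alpha> * (\<epsilon> * \<bar>\<alpha> \<bullet> z\<bar> / (1 + \<epsilon> * t * \<bar>\<alpha> \<bullet> z\<bar>))) = k \<alpha> * (1 - 1 / (1 + Y \<alpha>))" for \<alpha>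
        using Y0[of \<alpha>] by (simp add: Y_def field_simps)
      then have "t * (\<Sum>\<alpha>\<in>P. k \<alpha> * (\<epsilon> * \<bar>\<alpha> \<bullet> z\<bar> / (1 + \<epsilon> * t * \<bar>\<alpha> \<bullet> z\<bar>)))
          = (\<Sum>\<alpha>\<in>P. k \<alpha> * (1 - 1 / (1 + Y \<alpha>)))"
        by (simp only: sum_distrib_left)
      then show ?thesis unfolding L'_def Q_def distrib_left by simp
    qed
    ultimately have "t * (z \<bullet> \<mu>) + t * L' z t =
        - (K * Q z) + (\<Sum>\<alpha>\<in>P. k \<alpha> * (1 - 1 / (1 + Y \<alpha>))) + Q z / (1 + Q z)"
      by (simp add: right_diff_distrib)
    moreover have "Q z / (1 + Q z) \<le> Q z"
      using Q0[OF z] by (simp add: field_simps)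
    ultimately have lin: "t * (z \<bullet> \<mu>) + t * L' z t
        \<le> - (2 * \<kappa> * Q z) + (\<Sum>\<alpha>\<in>P. k \<alpha> * (1 - 1 / (1 + Y \<alpha>)))"
      by (simp add: K_def algebra_simps)
    have "- (\<Sum>\<alpha>\<in>P. k \<alpha> * (U\<^sup>2 - u z t \<bullet> u (refl_root \<alpha> z) t))
        = (\<Sum>\<alpha>\<in>P. k \<alpha> * (u z t \<bullet> u (refl_root \<alpha> z) t - U\<^sup>2))"
      by (simp add: sum_negf[symmetric] right_diff_distrib)
    also have "\<dots> \<le> (\<Sum>\<alpha>\<in>P. k \<alpha> * ((1 / (1 + Y \<alpha>) + 2 * Q z) * U\<^sup>2 - U\<^sup>2))"
      using refl k(2) by (intro sum_mono mult_left_mono) auto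
    also have "\<dots> = (2 * \<kappa> * Q z - (\<Sum>\<alpha>\<in>P. k \<alpha> * (1 - 1 / (1 + Y \<alpha>)))) * U\<^sup>2"
      by (simp add: \<kappa>_def sum_distrib_left sum_distrib_right sum_subtractf[symmetric] algebra_simps
          del: sum_subtractf)
    \<comment> \<open>The terms \<open>1 - 1 / (1 + Y \<alpha>)\<close> match those coming from the
      derivative of \<open>S\<close>, and the damping absorbs
      \<open>2 * \<kappa> * Q z\<close>.\<close>
    also have "\<dots> \<le> - (t * (z \<bullet> \<mu>) + t * L' z t) * U\<^sup>2"
      using lin by (intro mult_right_mono) auto
    finally have "t * (u z t \<bullet> u' z t + L' z t * U\<^sup>2) \<le> 0"
      unfolding distrib_left inner_u' by (simp add: algebra_simps)
    then show "u z t \<bullet> u' z t + L' z t * (norm (u z t))\<^sup>2 \<le> 0"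
      using t by (simp add: U_def mult_le_0_iff)
  qed (rule xI)
  moreover have "Omega_inv_sqrt P k (\<epsilon> *\<^sub>R x) = exp (- S x 1)"
  proof -
    have "(1 + \<bar>\<alpha> \<bullet> (\<epsilon> *\<^sub>R x)\<bar>) powr (- k \<alpha>) = exp (- (k \<alpha> * ln (1 + \<epsilon> * 1 * \<bar>\<alpha> \<bullet> x\<bar>)))" for \<alpha>
      using \<epsilon> pos(1)[OF xI, of 1 \<alpha>] by (simp add: powr_def abs_mult)
    then show ?thesis
      using finite_P by (simp add: Omega_inv_sqrt_def S_def exp_sum sum_negf[symmetric])
  qed
  \<comment> \<open>Because \<open>q x = 0\<close>, the auxiliary factor is 1 at the point of
    interest.\<close>
  moreover have "exp (L x 1) = exp (- (\<mu> \<bullet> x)) * exp (S x 1)"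
    by (simp add: L_def q_def exp_diff exp_minus field_simps)
  ultimately have "cmod (f x) * (exp (- (\<mu> \<bullet> x)) * exp (S x 1)) \<le> 1" by (simp add: u_def)
  then have "cmod (f x) \<le> exp (\<mu> \<bullet> x) * exp (- S x 1)"
    by (simp add: exp_minus field_simps)
  then show ?thesis
    using \<open>Omega_inv_sqrt P k (\<epsilon> *\<^sub>R x) = exp (- S x 1)\<close> by (simp add: \<epsilon>_def K_def \<kappa>_def)
qed

end

text \<open>For \<epsilon> at most 1, \<open>\<epsilon> * (1 + r) \<le> 1 + \<epsilon> * r\<close>,
  and the nonpositive exponents reverse this. The scaled argument is thus traded for a
  constant.\<close>

lemma Omega_inv_sqrt_scaleR_le:
  assumes \<epsilon>: "0 < \<epsilon>" "\<epsilon> \<le> 1" and k: "\<And>\<alpha>. \<alpha> \<in> P \<Longrightarrow> 0 \<le> k \<alpha>"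
  shows "Omega_inv_sqrt P k (\<epsilon> *\<^sub>R x) \<le> (\<Prod>\<alpha>\<in>P. \<epsilon> powr (- k \<alpha>)) * Omega_inv_sqrt P k x"
proof -
  have "(1 + \<bar>\<alpha> \<bullet> (\<epsilon> *\<^sub>R x)\<bar>) powr (- k \<alpha>) \<le> \<epsilon> powr (- k \<alpha>) * (1 + \<bar>\<alpha> \<bullet> x\<bar>) powr (- k \<alpha>)"
    if "\<alpha> \<in> P" for \<alpha>
  proof -
    have "(1 + \<bar>\<alpha> \<bullet> (\<epsilon> *\<^sub>R x)\<bar>) powr (- k \<alpha>) \<le> (\<epsilon> * (1 + \<bar>\<alpha> \<bullet> x\<bar>)) powr (- k \<alpha>)"
      using \<epsilon> k[OF that]
      by (intro powr_mono2') (auto simp: abs_mult distrib_left intro!: mult_pos_pos add_pos_nonneg)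
    then show ?thesis using \<epsilon> by (simp add: powr_mult)
  qed
  then show ?thesis
    unfolding Omega_inv_sqrt_def prod.distrib[symmetric] by (intro prod_mono) auto
qed

text \<open>The real slice is affine, so the chain rule restricts the joint derivative to
  it.\<close>

lemma entire2_differentiable:
  assumes "entire2 F"
  shows "(\<lambda>y. F \<nu> (cplx_of y)) differentiable at x"
proof -
  obtain D where D: "((\<lambda>(z, w). F z w) has_derivative D) (at (\<nu>, cplx_of x))"
    using assms unfolding entire2_def by blast
  have "((\<lambda>y. (\<nu>, cplx_of y)) has_derivative (\<lambda>h. (0, (h, 0)))) (at x)"
    unfolding cplx_of_def by (intro derivative_intros)
  from has_derivative_compose[OF this D] show ?thesis
    unfolding differentiable_def by auto
qed

theorem corollary2p3:
  fixes R P :: "'a::euclidean_space set"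
    and k :: "'a \<Rightarrow> real"
    and Exp :: "'a cplx \<Rightarrow> 'a cplx \<Rightarrow> complex"
    and \<mu> :: 'a
  assumes "root_system R"
    and "positive_roots R P"
    and "weyl_invariant R k"
    and "\<forall>\<alpha>\<in>R. k \<alpha> \<ge> 0"
    and "is_dunkl_kernel P (\<lambda>\<alpha>. complex_of_real (k \<alpha>)) Exp"
    and "\<mu> \<in> weyl_chamber P"
  shows "\<exists>C\<ge>0. \<forall>x\<in>closure (weyl_chamber P).
           cmod (Exp (cplx_of \<mu>) (cplx_of x)) \<le> C * exp (\<mu> \<bullet> x) * Omega_inv_sqrt P k x"
proof -
  interpret chamber_vector R P \<mu> using assms by unfold_locales
  \<comment> \<open>Inserting 1 forces \<open>c \<le> 1\<close> and hence
    \<open>\<epsilon> \<le> 1\<close>, as the rescaling of the weight requires.\<close>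
  define c where "c = Min (insert 1 ((\<lambda>\<alpha>. \<alpha> \<bullet> \<mu>) ` P))"
  have c: "0 < c" "c \<le> 1" "\<And>\<alpha>. \<alpha> \<in> P \<Longrightarrow> c \<le> \<alpha> \<bullet> \<mu>"
    unfolding c_def using finite_P inner_chamber_pos by (auto simp: Min_gr_iff)
  have k: "0 \<le> k \<alpha>" if "\<alpha> \<in> P" for \<alpha> using assms(4) that P_subset by blast
  define \<epsilon> where "\<epsilon> = c / (1 + 2 * (\<Sum>\<alpha>\<in>P. k \<alpha>))"
  have "0 \<le> (\<Sum>\<alpha>\<in>P. k \<alpha>)" using k by (rule sum_nonneg)
  then have \<epsilon>: "0 < \<epsilon>" "\<epsilon> \<le> 1" using c by (auto simp: \<epsilon>_def divide_le_eq)
  define f where "f y = Exp (cplx_of \<mu>) (cplx_of y)" for y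
  have E: "entire2 Exp" "Exp (cplx_of \<mu>) 0 = 1"
    "\<And>\<xi> y. dunkl_op P (\<lambda>\<alpha>. of_real (k \<alpha>)) \<xi> f y = cform (cplx_of \<xi>) (cplx_of \<mu>) * f y"
    using assms(5) unfolding is_dunkl_kernel_def f_def by blast+
  have cf: "cform (cplx_of \<xi>) (cplx_of \<mu>) = of_real (\<xi> \<bullet> \<mu>)" for \<xi>
    by (simp add: cform_def cplx_of_def complex_eq_iff)
  have f0: "f 0 = 1" using E(2) by (simp add: f_def cplx_of_def zero_prod_def)
  have df: "f differentiable at y" for y
    unfolding f_def by (rule entire2_differentiable[OF E(1)])
  \<comment> \<open>This is the cost of undoing the scaling by \<epsilon>; it depends on
    \<open>P\<close>, \<open>k\<close> and \<mu> but not on \<open>x\<close>.\<close>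
  let ?C = "\<Prod>\<alpha>\<in>P. \<epsilon> powr (- k \<alpha>)"
  show ?thesis
  proof (intro exI[of _ ?C] conjI ballI)
    show "0 \<le> ?C" by (intro prod_nonneg) simp
    fix x assume x: "x \<in> closure (weyl_chamber P)"
    have "cmod (f x) \<le> exp (\<mu> \<bullet> x) * Omega_inv_sqrt P k (\<epsilon> *\<^sub>R x)"
      unfolding \<epsilon>_def using E(3) unfolding cf
      by (intro dunkl_eigenfunction_bound[OF assms(3) k df f0 _ c(1,3) x]) auto
    also have "\<dots> \<le> exp (\<mu> \<bullet> x) * (?C * Omega_inv_sqrt P k x)"
      using Omega_inv_sqrt_scaleR_le[OF \<epsilon> k] by (intro mult_left_mono) auto
    finally show "cmod (Exp (cplx_of \<mu>) (cplx_of x)) \<le> ?C * exp (\<mu> \<bullet> x) * Omega_inv_sqrt P k x"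
      by (simp add: f_def mult_ac)
  qed
qed

end
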